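(* Let $\mathfrak{g}$ be a (finite-dimensional, real) unimodular Lie algebra with Killing form zero. If $\mathfrak{g}$ has an Einstein metric with nonzero scalar curvature, then $\operatorname{Der}(\mathfrak{g})\subset\mathfrak{sl}(\mathfrak{g})$, i.e. every derivation of $\mathfrak{g}$ has trace zero.
   Context: A metric on a real Lie algebra $\mathfrak{g}$ is a non-degenerate symmetric bilinear form on $\mathfrak{g}$ of arbitrary signature; it is identified with the left-invariant pseudoriemannian metric it defines on a Lie group with Lie algebra $\mathfrak{g}$, and its Ricci tensor, Ricci operator $\operatorname{ric}\colon\mathfrak{g}\to\mathfrak{g}$ and scalar curvature $s=\operatorname{tr}\operatorname{ric}$ are those of that left-invariant metric. The metric is Einstein if $\operatorname{ric}=\lambda\,\mathrm{Id}$ for some $\lambda\in\mathbb{R}$. $\operatorname{Der}(\mathfrak{g})$ is the space of linear maps $X\colon\mathfrak{g}\to\mathfrak{g}$ with $X[v,w]=[Xv,w]+[v,Xw]$ for all $v,w\in\mathfrak{g}$. $\mathfrak{g}$ is unimodular if $\operatorname{tr}\operatorname{ad}(v)=0$ for all $v$. *)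

theory Defs
  imports "HOL-Analysis.Analysis"
begin

text \<open>
  The Lie algebra has a whole type of class \<open>real_vector\<close> as underlying space;
  finite dimensionality is the assumption
  \<open>\<exists>B. finite_dimensional_vector_space (*\<^sub>R) B\<close>, where \<open>B\<close> is a finite basis.
  No norm or topology is used. Trace and Ricci operator are only meaningful under that
  assumption.
\<close>

section \<open>Trace of an endomorphism\<close>

text \<open>Independent of the basis by \<open>lin_trace_eq\<close> below.\<close>

definition lin_trace :: "('a::real_vector \<Rightarrow> 'a) \<Rightarrow> real" where
  "lin_trace f = (\<Sum>b\<in>extend_basis {}. representation (extend_basis {}) (f b) b)"

lemma basis_expansion:
  fixes B :: "'a::real_vector set"
  assumes "finite_dimensional_vector_space (*\<^sub>R) B"
  shows "(\<Sum>b\<in>B. representation B v b *\<^sub>R b) = v"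
proof -
  interpret finite_dimensional_vector_space "(*\<^sub>R) :: real \<Rightarrow> 'a \<Rightarrow> 'a" B by fact
  show ?thesis
    using real_vector.sum_representation_eq[of B v B] independent_Basis span_Basis finite_Basis
    by (simp add: dependent_raw_def span_raw_def)
qed

lemma sum_representation_swap:
  fixes B C :: "'a::real_vector set"
  assumes B: "finite_dimensional_vector_space (*\<^sub>R) B"
    and C: "finite_dimensional_vector_space (*\<^sub>R) C"
    and f: "linear f"
  shows "(\<Sum>b\<in>B. representation B (f b) b) = (\<Sum>c\<in>C. representation C (f c) c)"
proof -
  have lin: "linear (\<lambda>v. representation D v d)"
    if "finite_dimensional_vector_space (*\<^sub>R) D" for D :: "'a set" and d
  proof -
    interpret D: finite_dimensional_vector_space "(*\<^sub>R) :: real \<Rightarrow> 'a \<Rightarrow> 'a" D by fact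
    have "independent D" "span D = UNIV"
      using D.independent_Basis D.span_Basis by (simp_all add: dependent_raw_def span_raw_def)
    then show ?thesis
      by (intro linearI) (simp_all add: representation_add representation_scale)
  qed
  have "(\<Sum>b\<in>B. representation B (f b) b)
      = (\<Sum>b\<in>B. representation B (f (\<Sum>c\<in>C. representation C b c *\<^sub>R c)) b)"
    by (simp add: basis_expansion[OF C])
  also have "\<dots> = (\<Sum>b\<in>B. \<Sum>c\<in>C. representation C b c * representation B (f c) b)"
    by (simp add: linear_sum[OF f] linear_sum[OF lin[OF B]] linear_scale[OF f]
        linear_scale[OF lin[OF B]])
  also have "\<dots> = (\<Sum>c\<in>C. \<Sum>b\<in>B. representation B (f c) b * representation C b c)"
    by (subst sum.swap) (simp add: mult.commute)
  also have "\<dots> = (\<Sum>c\<in>C. representation C (\<Sum>b\<in>B. representation B (f c) b *\<^sub>R b) c)"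
    by (simp add: linear_sum[OF lin[OF C]] linear_scale[OF lin[OF C]])
  finally show ?thesis by (simp add: basis_expansion[OF B])
qed

lemma lin_trace_eq:
  fixes B :: "'a::real_vector set"
  assumes B: "finite_dimensional_vector_space (*\<^sub>R) B" and f: "linear f"
  shows "lin_trace f = (\<Sum>b\<in>B. representation B (f b) b)"
proof -
  interpret B: finite_dimensional_vector_space "(*\<^sub>R) :: real \<Rightarrow> 'a \<Rightarrow> 'a" B by fact
  have E: "independent (extend_basis {} :: 'a set)" "span (extend_basis {} :: 'a set) = UNIV"
    by (simp_all add: independent_extend_basis span_extend_basis independent_empty)
  have "finite (extend_basis {} :: 'a set)"
    using B.finiteI_independent E by (simp add: dependent_raw_def)
  with E have "finite_dimensional_vector_space (*\<^sub>R) (extend_basis {} :: 'a set)"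
    by unfold_locales (simp_all add: dependent_raw_def span_raw_def)
  from sum_representation_swap[OF this B f] show ?thesis
    unfolding lin_trace_def .
qed

section \<open>Lie algebras\<close>

definition lie_algebra :: "('a::real_vector \<Rightarrow> 'a \<Rightarrow> 'a) \<Rightarrow> bool" where
  "lie_algebra br \<longleftrightarrow> bilinear br \<and> (\<forall>x. br x x = 0) \<and>
    (\<forall>x y z. br x (br y z) + br y (br z x) + br z (br x y) = 0)"

definition unimodular :: "('a::real_vector \<Rightarrow> 'a \<Rightarrow> 'a) \<Rightarrow> bool" where
  "unimodular br \<longleftrightarrow> (\<forall>v. lin_trace (br v) = 0)"

definition killing_form :: "('a::real_vector \<Rightarrow> 'a \<Rightarrow> 'a) \<Rightarrow> 'a \<Rightarrow> 'a \<Rightarrow> real" where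
  "killing_form br v w = lin_trace (br v \<circ> br w)"

definition lie_der :: "('a::real_vector \<Rightarrow> 'a \<Rightarrow> 'a) \<Rightarrow> ('a \<Rightarrow> 'a) set" where
  "lie_der br = {X. linear X \<and> (\<forall>v w. X (br v w) = br (X v) w + br v (X w))}"

definition traceless :: "('a::real_vector \<Rightarrow> 'a) set" where
  "traceless = {X. linear X \<and> lin_trace X = 0}"

section \<open>Metrics and curvature\<close>

definition lie_metric :: "('a::real_vector \<Rightarrow> 'a \<Rightarrow> real) \<Rightarrow> bool" where
  "lie_metric g \<longleftrightarrow> bilinear g \<and> (\<forall>x y. g x y = g y x) \<and> (\<forall>x. (\<forall>y. g x y = 0) \<longrightarrow> x = 0)"

text \<open>
  Restriction of the Levi-Civita connection of the left-invariant metric to left-invariant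
  vector fields. Since \<open>g\<close> is constant on such fields, metric compatibility means that
  each \<open>D x\<close> is skew-symmetric.
\<close>

definition is_levi_civita ::
  "('a::real_vector \<Rightarrow> 'a \<Rightarrow> 'a) \<Rightarrow> ('a \<Rightarrow> 'a \<Rightarrow> real) \<Rightarrow> ('a \<Rightarrow> 'a \<Rightarrow> 'a) \<Rightarrow> bool" where
  "is_levi_civita br g D \<longleftrightarrow> bilinear D \<and> (\<forall>x y. D x y - D y x = br x y) \<and>
    (\<forall>x y z. g (D x y) z + g y (D x z) = 0)"

definition levi_civita ::
  "('a::real_vector \<Rightarrow> 'a \<Rightarrow> 'a) \<Rightarrow> ('a \<Rightarrow> 'a \<Rightarrow> real) \<Rightarrow> 'a \<Rightarrow> 'a \<Rightarrow> 'a" where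
  "levi_civita br g = (THE D. is_levi_civita br g D)"

definition curvature ::
  "('a::real_vector \<Rightarrow> 'a \<Rightarrow> 'a) \<Rightarrow> ('a \<Rightarrow> 'a \<Rightarrow> real) \<Rightarrow> 'a \<Rightarrow> 'a \<Rightarrow> 'a \<Rightarrow> 'a" where
  "curvature br g x y z = (let D = levi_civita br g in
    D x (D y z) - D y (D x z) - D (br x y) z)"

text \<open>Sign convention: the Ricci tensor of a round sphere is positive.\<close>

definition ricci_tensor ::
  "('a::real_vector \<Rightarrow> 'a \<Rightarrow> 'a) \<Rightarrow> ('a \<Rightarrow> 'a \<Rightarrow> real) \<Rightarrow> 'a \<Rightarrow> 'a \<Rightarrow> real" where
  "ricci_tensor br g y z = lin_trace (\<lambda>x. curvature br g x y z)"

definition ricci_operator ::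
  "('a::real_vector \<Rightarrow> 'a \<Rightarrow> 'a) \<Rightarrow> ('a \<Rightarrow> 'a \<Rightarrow> real) \<Rightarrow> 'a \<Rightarrow> 'a" where
  "ricci_operator br g v = (THE u. \<forall>w. g u w = ricci_tensor br g v w)"

definition scalar_curvature ::
  "('a::real_vector \<Rightarrow> 'a \<Rightarrow> 'a) \<Rightarrow> ('a \<Rightarrow> 'a \<Rightarrow> real) \<Rightarrow> real" where
  "scalar_curvature br g = lin_trace (ricci_operator br g)"

definition einstein ::
  "('a::real_vector \<Rightarrow> 'a \<Rightarrow> 'a) \<Rightarrow> ('a \<Rightarrow> 'a \<Rightarrow> real) \<Rightarrow> bool" where
  "einstein br g \<longleftrightarrow> (\<exists>c. \<forall>v. ricci_operator br g v = c *\<^sub>R v)"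

section \<open>The definite descriptions are well defined\<close>

lemma lie_metric_riesz:
  fixes g :: "'a::real_vector \<Rightarrow> 'a \<Rightarrow> real" and B :: "'a set"
  assumes B: "finite_dimensional_vector_space (*\<^sub>R) B" and g: "lie_metric g" and f: "linear f"
  shows "\<exists>!u. \<forall>w. g u w = f w"
proof (rule ex_ex1I)
  interpret B: finite_dimensional_vector_space "(*\<^sub>R) :: real \<Rightarrow> 'a \<Rightarrow> 'a" B by fact
  have ind: "independent B" and sp: "span B = UNIV"
    using B.independent_Basis B.span_Basis by (simp_all add: dependent_raw_def span_raw_def)
  have bil: "bilinear g" and nd: "\<And>x. (\<And>y. g x y = 0) \<Longrightarrow> x = 0"
    using g unfolding lie_metric_def by auto
  have l1: "linear (\<lambda>x. g x y)" and l2: "linear (g x)" for x y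
    using bil unfolding bilinear_def by auto
  have agree: "\<phi> = \<psi>" if "linear \<phi>" "linear \<psi>" "\<And>b. b \<in> B \<Longrightarrow> \<phi> b = \<psi> b" for \<phi> \<psi> :: "'a \<Rightarrow> real"
    using linear_eq_on_span[OF that(1,2), of B] that(3) sp by auto
  define L where "L v = (\<Sum>b\<in>B. g v b *\<^sub>R b)" for v
  have linL: "linear L"
    by (intro linearI) (simp_all add: L_def linear_add[OF l1] linear_scale[OF l1]
        sum.distrib scaleR_add_left scaleR_sum_right)
  have coords: "\<alpha> b = \<beta> b" if "(\<Sum>b\<in>B. \<alpha> b *\<^sub>R b) = (\<Sum>b\<in>B. \<beta> b *\<^sub>R b)" "b \<in> B" for \<alpha> \<beta> b
  proof -
    have "(\<Sum>b\<in>B. (\<alpha> b - \<beta> b) *\<^sub>R b) = 0"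
      using that(1) by (simp add: scaleR_diff_left sum_subtractf)
    then show ?thesis
      using independentD[OF ind B.finite_Basis subset_refl, of "\<lambda>b. \<alpha> b - \<beta> b" b] that(2) by simp
  qed
  have "inj L"
  proof (rule injI)
    fix u v assume "L u = L v"
    then have "g u b = g v b" if "b \<in> B" for b
      using coords[of "g u" "g v" b] that unfolding L_def by simp
    then have "g u = g v" using agree l2 by blast
    then have "g (u - v) y = 0" for y
      by (simp add: bilinear_lsub[OF bil])
    from nd[OF this] show "u = v" by simp
  qed
  moreover have "Vector_Spaces.linear (*\<^sub>R) (*\<^sub>R) L"
    using linL by (simp add: linear_def)
  ultimately have "surj L" using B.linear_inj_imp_surj by blast
  then obtain u where "L u = (\<Sum>b\<in>B. f b *\<^sub>R b)" by (metis surjD)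
  then have "g u b = f b" if "b \<in> B" for b
    using coords[of "g u" f b] that unfolding L_def by simp
  then show "\<exists>u. \<forall>w. g u w = f w" using agree[OF l2 f] by metis
  fix u v assume "\<forall>w. g u w = f w" "\<forall>w. g v w = f w"
  then have "g (u - v) y = 0" for y by (simp add: bilinear_lsub[OF bil])
  from nd[OF this] show "u = v" by simp
qed

lemma levi_civita_unique_existence:
  fixes br :: "'a::real_vector \<Rightarrow> 'a \<Rightarrow> 'a" and B :: "'a set"
  assumes B: "finite_dimensional_vector_space (*\<^sub>R) B" and br: "lie_algebra br" and g: "lie_metric g"
  shows "\<exists>!D. is_levi_civita br g D"
proof -
  have bil: "bilinear g" and sym: "\<And>x y. g x y = g y x" and nd: "\<And>x. (\<And>y. g x y = 0) \<Longrightarrow> x = 0"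
    using g unfolding lie_metric_def by auto
  have bb: "bilinear br" and alt: "\<And>x. br x x = 0"
    using br unfolding lie_algebra_def by auto
  note bi = bilinear_ladd bilinear_radd bilinear_lmul bilinear_rmul bilinear_lneg bilinear_rneg
    bilinear_lsub bilinear_rsub
  note G = bi[OF bil] and R = bi[OF bb]
  have anti: "br x y = - br y x" for x y
  proof -
    have "br (x + y) (x + y) = br x y + br y x"
      unfolding R by (simp add: alt)
    then show ?thesis by (simp add: alt eq_neg_iff_add_eq_0)
  qed
  have ganti: "g (br x y) z = - g (br y x) z" for x y z
    by (subst anti) (simp only: G)
  have eqI: "u = v" if "\<And>z. g u z = g v z" for u v
    using nd[of "u - v"] that by (simp add: G)
  define K where "K x y z = (g (br x y) z - g (br y z) x + g (br z x) y) / 2" for x y z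
  have linK: "linear (K x y)" for x y
    by (intro linearI) (simp_all add: K_def G R algebra_simps add_divide_distrib diff_divide_distrib)
  define D where "D x y = (THE u. \<forall>w. g u w = K x y w)" for x y
  have D: "g (D x y) w = K x y w" for x y w
    using theI'[OF lie_metric_riesz[OF B g linK[of x y]]] unfolding D_def by blast
  have "bilinear D"
    unfolding bilinear_def
    by (intro conjI allI linearI; rule eqI)
      (simp_all add: G D, simp_all add: K_def G R algebra_simps add_divide_distrib diff_divide_distrib)
  moreover have "D x y - D y x = br x y" for x y
  proof (rule eqI)
    fix z
    have "(p - q + r) / 2 - (p' - r' + q') / 2 = p" if "p' = - p" "q' = - q" "r = - r'"
      for p q r p' q' r' :: real
      using that by (simp add: field_simps)
    from this[OF ganti ganti ganti] show "g (D x y - D y x) z = g (br x y) z"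
      unfolding G D K_def .
  qed
  moreover have "g (D x y) z + g y (D x z) = 0" for x y z
  proof -
    have "(p - q + r) / 2 + (r' - q' + p') / 2 = 0" if "p' = - p" "q' = - q" "r = - r'"
      for p q r p' q' r' :: real
      using that by (simp add: field_simps)
    from this[OF ganti ganti ganti] show ?thesis
      unfolding sym[of y "D x z"] D K_def .
  qed
  ultimately have ex: "is_levi_civita br g D" unfolding is_levi_civita_def by blast
  have koszul: "g (E x y) z = K x y z" if "is_levi_civita br g E" for E x y z
  proof -
    have t: "br x y = E x y - E y x" for x y
      using that unfolding is_levi_civita_def by metis
    have m: "g (E x z) y = - g (E x y) z" for x y z
    proof -
      have "g (E x y) z + g y (E x z) = 0"
        using that unfolding is_levi_civita_def by blast
      then show ?thesis unfolding sym[of y "E x z"] by linarith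
    qed
    have "a = (a - b - (c - d) + (e - f)) / 2" if "f = - a" "c = - b" "e = - d"
      for a b c d e f :: real
      using that by (simp add: field_simps)
    from this[OF m m m] show ?thesis
      unfolding K_def t G .
  qed
  have "E = D" if "is_levi_civita br g E" for E
  proof (intro ext eqI)
    fix x y z show "g (E x y) z = g (D x y) z"
      using koszul[OF that] D by simp
  qed
  with ex show ?thesis by blast
qed

lemma is_levi_civita_levi_civita:
  fixes br :: "'a::real_vector \<Rightarrow> 'a \<Rightarrow> 'a" and B :: "'a set"
  assumes "finite_dimensional_vector_space (*\<^sub>R) B" "lie_algebra br" "lie_metric g"
  shows "is_levi_civita br g (levi_civita br g)"
  unfolding levi_civita_def using levi_civita_unique_existence[OF assms] by (rule theI')

lemma linear_curvature:
  assumes "bilinear br" "bilinear (levi_civita br g)"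
  shows "linear (\<lambda>x. curvature br g x y z)" "linear (\<lambda>z. curvature br g x y z)"
proof -
  note bi = bilinear_ladd bilinear_radd bilinear_lmul bilinear_rmul
  note rules = curvature_def Let_def bi[OF assms(1)] bi[OF assms(2)]
  show "linear (\<lambda>x. curvature br g x y z)"
    by (intro linearI) (simp_all add: rules scaleR_diff_right)
  show "linear (\<lambda>z. curvature br g x y z)"
    by (intro linearI) (simp_all add: rules scaleR_diff_right)
qed

lemma ricci_operator_tensor:
  fixes br :: "'a::real_vector \<Rightarrow> 'a \<Rightarrow> 'a" and B :: "'a set"
  assumes B: "finite_dimensional_vector_space (*\<^sub>R) B" and br: "lie_algebra br" and g: "lie_metric g"
  shows "g (ricci_operator br g v) w = ricci_tensor br g v w"
proof -
  interpret B: finite_dimensional_vector_space "(*\<^sub>R) :: real \<Rightarrow> 'a \<Rightarrow> 'a" B by fact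
  have ind: "independent B" and sp: "span B = UNIV"
    using B.independent_Basis B.span_Basis by (simp_all add: dependent_raw_def span_raw_def)
  have bb: "bilinear br" using br unfolding lie_algebra_def by blast
  have bD: "bilinear (levi_civita br g)"
    using is_levi_civita_levi_civita[OF assms] unfolding is_levi_civita_def by blast
  note lc = linear_curvature[OF bb bD]
  have "ricci_tensor br g v = (\<lambda>w. \<Sum>b\<in>B. representation B (curvature br g b v w) b)"
    by (simp add: fun_eq_iff ricci_tensor_def lin_trace_eq[OF B lc(1)])
  then have "linear (ricci_tensor br g v)"
    by (auto intro!: linearI simp: linear_add[OF lc(2)] linear_scale[OF lc(2)]
        representation_add[OF ind] representation_scale[OF ind] sp sum.distrib sum_distrib_left)
  from theI'[OF lie_metric_riesz[OF B g this]] show ?thesis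
    unfolding ricci_operator_def by blast
qed

end

theory Submission
  imports Defs
begin

text \<open>
  Write \<open>ad\<^sub>y = D\<^sub>y - R\<^sub>y\<close> with \<open>R\<^sub>y x = D\<^sub>x y\<close>. Unimodularity reduces the Ricci tensor to
  \<open>Ric(y, z) = - tr (R\<^sub>y R\<^sub>z)\<close>. Since \<open>D\<^sub>y\<close> is skew, the self-adjoint part of \<open>R\<^sub>y\<close> is minus
  that of \<open>ad\<^sub>y\<close>, while \<open>J\<^sub>y = R\<^sub>y - R\<^sub>y\<^sup>*\<close> satisfies \<open>g (J\<^sub>y x) z = g [z, x] y\<close>. With vanishing
  Killing form this gives \<open>- 4 Ric(y, z) = 2 tr (ad\<^sub>y ad\<^sub>z\<^sup>*) + tr (J\<^sub>y J\<^sub>z)\<close>. For a derivation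
  \<open>X\<close>, contracting \<open>y = X e\<^sub>i\<close> with \<open>z = e\<^sup>i\<close> makes the two terms cancel, so
  \<open>tr (ric \<circ> X) = 0\<close>; if \<open>ric = \<lambda> Id\<close> with \<open>\<lambda> \<noteq> 0\<close>, then \<open>tr X = 0\<close>.
\<close>

section \<open>Traces and adjoints with respect to a metric\<close>

locale metric_with_basis =
  fixes g :: "'a::real_vector \<Rightarrow> 'a \<Rightarrow> real" and B :: "'a set"
  assumes basis: "finite_dimensional_vector_space (*\<^sub>R) B"
    and metric: "lie_metric g"
begin

text \<open>The \<open>g\<close>-dual basis of \<open>B\<close>: \<open>dual b\<close> represents
  the coordinate functional of \<open>b\<close>. Pairs \<open>b\<close>, \<open>dual b\<close>
  replace an orthonormal basis in arbitrary signature.\<close>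

definition dual :: "'a \<Rightarrow> 'a" where
  "dual b = (THE u. \<forall>w. g u w = representation B w b)"

text \<open>Written out in the dual basis, \<open>adj f\<close> is linear by construction; for
  linear \<open>f\<close> it is the \<open>g\<close>-adjoint by \<open>g_adj\<close>.\<close>

definition adj :: "('a \<Rightarrow> 'a) \<Rightarrow> 'a \<Rightarrow> 'a" where
  "adj f y = (\<Sum>b\<in>B. g y (f b) *\<^sub>R dual b)"

lemma bilinear_g: "bilinear g"
  and g_sym: "g x y = g y x"
  and nondegenerate: "(\<And>y. g x y = 0) \<Longrightarrow> x = 0"
  using metric unfolding lie_metric_def by auto

lemmas g_simps = bilinear_ladd[OF bilinear_g] bilinear_radd[OF bilinear_g]
  bilinear_lmul[OF bilinear_g] bilinear_rmul[OF bilinear_g]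
  bilinear_lneg[OF bilinear_g] bilinear_rneg[OF bilinear_g]
  bilinear_lsub[OF bilinear_g] bilinear_rsub[OF bilinear_g]

lemma linear_g_left: "linear (\<lambda>x. g x y)" and linear_g_right: "linear (g x)"
  using bilinear_g unfolding bilinear_def by auto

lemma g_eqI:
  assumes "\<And>z. g u z = g v z"
  shows "u = v"
  using nondegenerate[of "u - v"] assms by (simp add: g_simps)

lemma g_dual: "g (dual b) w = representation B w b"
proof -
  interpret B: finite_dimensional_vector_space "(*\<^sub>R) :: real \<Rightarrow> 'a \<Rightarrow> 'a" B by (fact basis)
  have "independent B" "span B = UNIV"
    using B.independent_Basis B.span_Basis by (simp_all add: dependent_raw_def span_raw_def)
  then have "linear (\<lambda>w. representation B w b)"
    by (intro linearI) (simp_all add: representation_add representation_scale)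
  from theI'[OF lie_metric_riesz[OF basis metric this]] show ?thesis
    unfolding dual_def by blast
qed

lemma expansion: "(\<Sum>b\<in>B. g (dual b) v *\<^sub>R b) = v"
  unfolding g_dual by (rule basis_expansion[OF basis])

lemma parseval: "(\<Sum>b\<in>B. g (dual b) v * g b w) = g v w"
proof -
  have "g v w = g (\<Sum>b\<in>B. g (dual b) v *\<^sub>R b) w" by (simp add: expansion)
  then show ?thesis by (simp add: linear_sum[OF linear_g_left] g_simps)
qed

lemma trace_eq: "linear f \<Longrightarrow> lin_trace f = (\<Sum>b\<in>B. g (dual b) (f b))"
  unfolding g_dual by (rule lin_trace_eq[OF basis])

lemma linear_comp_apply: "linear f \<Longrightarrow> linear h \<Longrightarrow> linear (\<lambda>x. f (h x))"
  using linear_compose[of h f] by (simp add: o_def)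

lemma trace_add:
  "linear f \<Longrightarrow> linear h \<Longrightarrow> lin_trace (\<lambda>x :: 'a. f x + h x) = lin_trace f + lin_trace h"
  by (simp add: trace_eq linear_compose_add g_simps sum.distrib)

lemma trace_diff:
  "linear f \<Longrightarrow> linear h \<Longrightarrow> lin_trace (\<lambda>x :: 'a. f x - h x) = lin_trace f - lin_trace h"
  by (simp add: trace_eq linear_compose_sub g_simps sum_subtractf)

lemma trace_scale: "linear f \<Longrightarrow> lin_trace (\<lambda>x :: 'a. c *\<^sub>R f x) = c * lin_trace f"
  by (simp add: trace_eq linear_compose_scale_right g_simps sum_distrib_left)

text \<open>Expanding \<open>h b\<close> and \<open>f c\<close> in \<open>B\<close> turns both sides
  into the same double sum with the indices exchanged.\<close>

lemma trace_commute:
  fixes f h :: "'a \<Rightarrow> 'a"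
  assumes f: "linear f" and h: "linear h"
  shows "lin_trace (\<lambda>x. f (h x)) = lin_trace (\<lambda>x. h (f x))"
proof -
  have expand: "g u (f' v) = (\<Sum>c\<in>B. g (dual c) v * g u (f' c))" if f': "linear f'" for f' u v
  proof -
    have "g u (f' v) = g u (f' (\<Sum>c\<in>B. g (dual c) v *\<^sub>R c))" by (simp add: expansion)
    then show ?thesis
      by (simp add: linear_sum[OF f'] linear_sum[OF linear_g_right] linear_scale[OF f'] g_simps)
  qed
  have "lin_trace (\<lambda>x. f (h x)) = (\<Sum>b\<in>B. \<Sum>c\<in>B. g (dual c) (h b) * g (dual b) (f c))"
    by (simp add: trace_eq linear_comp_apply f h expand[OF f, of _ "h _"])
  also have "\<dots> = (\<Sum>c\<in>B. \<Sum>b\<in>B. g (dual b) (f c) * g (dual c) (h b))"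
    by (subst sum.swap) (simp add: mult.commute)
  also have "\<dots> = lin_trace (\<lambda>x. h (f x))"
    by (simp add: trace_eq linear_comp_apply f h expand[OF h, of _ "f _"])
  finally show ?thesis .
qed

section \<open>Adjoints and traces of products\<close>

lemma linear_adj: "linear (adj f)"
  by (intro linearI)
    (simp_all add: adj_def g_simps scaleR_add_left sum.distrib scaleR_sum_right)

lemma g_adj:
  assumes f: "linear f"
  shows "g (adj f y) x = g y (f x)"
proof -
  have "g y (f x) = g y (f (\<Sum>b\<in>B. g (dual b) x *\<^sub>R b))" by (simp add: expansion)
  then show ?thesis
    by (simp add: adj_def linear_sum[OF f] linear_sum[OF linear_g_right]
        linear_sum[OF linear_g_left] linear_scale[OF f] g_simps mult.commute)
qed

lemma adj_unique:
  assumes "linear f" "\<And>x y. g (h y) x = g y (f x)"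
  shows "adj f = h"
  using assms by (intro ext g_eqI) (simp add: g_adj)

text \<open>The coefficients \<open>g (dual c) (dual b)\<close> of \<open>dual b\<close> in
  \<open>B\<close> form the inverse Gram matrix; its symmetry lets \<open>parseval\<close> contract
  over \<open>b\<close> instead of \<open>c\<close>.\<close>

lemma trace_adj:
  assumes f: "linear f"
  shows "lin_trace (adj f) = lin_trace f"
proof -
  have "lin_trace (adj f) = (\<Sum>b\<in>B. g b (f (dual b)))"
    by (simp add: trace_eq linear_adj g_sym[of "dual _"] g_adj f)
  also have "\<dots> = (\<Sum>b\<in>B. \<Sum>c\<in>B. g (dual c) (dual b) * g b (f c))"
  proof (rule sum.cong[OF refl])
    fix b
    have "g b (f (dual b)) = g b (f (\<Sum>c\<in>B. g (dual c) (dual b) *\<^sub>R c))" by (simp add: expansion)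
    then show "g b (f (dual b)) = (\<Sum>c\<in>B. g (dual c) (dual b) * g b (f c))"
      by (simp add: linear_sum[OF f] linear_sum[OF linear_g_right] linear_scale[OF f] g_simps)
  qed
  also have "\<dots> = (\<Sum>c\<in>B. \<Sum>b\<in>B. g (dual b) (dual c) * g b (f c))"
    by (subst sum.swap) (simp add: g_sym[of "dual _" "dual _"])
  also have "\<dots> = lin_trace f"
    by (simp add: parseval trace_eq f)
  finally show ?thesis .
qed

lemma trace_skew:
  assumes f: "linear f" and skew: "\<And>x y. g (f x) y + g x (f y) = 0"
  shows "lin_trace f = 0"
proof -
  have "adj f = (\<lambda>x. (-1) *\<^sub>R f x)"
  proof (rule adj_unique[OF f])
    fix x y show "g ((-1) *\<^sub>R f y) x = g y (f x)"
      using skew[of y x] by (simp add: g_simps)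
  qed
  with trace_adj[OF f] trace_scale[OF f, of "-1"] show ?thesis by simp
qed

lemma trace_adj_comp:
  assumes f: "linear f" and h: "linear h"
  shows "lin_trace (\<lambda>x. adj f (adj h x)) = lin_trace (\<lambda>x. f (h x))"
proof -
  have "adj (\<lambda>x. h (f x)) = (\<lambda>x. adj f (adj h x))"
    by (rule adj_unique) (simp_all add: g_adj f h linear_comp_apply)
  with trace_adj[of "\<lambda>x. h (f x)"] show ?thesis
    by (simp add: f h linear_comp_apply trace_commute[OF f h])
qed

lemma trace_adj_left:
  assumes f: "linear f" and h: "linear h"
  shows "lin_trace (\<lambda>x. adj f (h x)) = lin_trace (\<lambda>x. f (adj h x))"
proof -
  have "adj (\<lambda>x. adj h (f x)) = (\<lambda>x. adj f (h x))"
    by (rule adj_unique)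
      (simp_all add: g_adj f h linear_adj linear_comp_apply g_sym[of _ "adj h _"] g_sym[of "h _"])
  with trace_adj[of "\<lambda>x. adj h (f x)"] show ?thesis
    by (simp add: f h linear_adj linear_comp_apply trace_commute[OF f linear_adj])
qed

text \<open>Of the four products, \<open>f h\<close> has the same trace as the product of both
  adjoints, and the two mixed products share theirs.\<close>

lemma trace_self_adjoint_parts:
  assumes f: "linear f" and h: "linear h"
  shows "lin_trace (\<lambda>x. (f (h x + adj h x)) + adj f (h x + adj h x))
    = 2 * lin_trace (\<lambda>x. f (h x)) + 2 * lin_trace (\<lambda>x. f (adj h x))"
proof -
  note lin = linear_comp_apply[OF f h] linear_comp_apply[OF f linear_adj[of h]]
    linear_comp_apply[OF linear_adj[of f] h] linear_comp_apply[OF linear_adj[of f] linear_adj[of h]]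
  show ?thesis
    unfolding linear_add[OF f] linear_add[OF linear_adj]
      trace_add[OF linear_compose_add[OF lin(1,2)] linear_compose_add[OF lin(3,4)]]
      trace_add[OF lin(1,2)] trace_add[OF lin(3,4)] trace_adj_comp[OF f h] trace_adj_left[OF f h]
    by simp
qed

lemma trace_skew_parts:
  assumes f: "linear f" and h: "linear h"
  shows "lin_trace (\<lambda>x. (f (h x - adj h x)) - adj f (h x - adj h x))
    = 2 * lin_trace (\<lambda>x. f (h x)) - 2 * lin_trace (\<lambda>x. f (adj h x))"
proof -
  note lin = linear_comp_apply[OF f h] linear_comp_apply[OF f linear_adj[of h]]
    linear_comp_apply[OF linear_adj[of f] h] linear_comp_apply[OF linear_adj[of f] linear_adj[of h]]
  show ?thesis
    unfolding linear_diff[OF f] linear_diff[OF linear_adj]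
      trace_diff[OF linear_compose_sub[OF lin(1,2)] linear_compose_sub[OF lin(3,4)]]
      trace_diff[OF lin(1,2)] trace_diff[OF lin(3,4)] trace_adj_comp[OF f h] trace_adj_left[OF f h]
    by simp
qed

end

section \<open>The Ricci tensor and derivations\<close>

locale metric_lie_algebra = metric_with_basis g B
  for br :: "'a::real_vector \<Rightarrow> 'a \<Rightarrow> 'a" and g :: "'a \<Rightarrow> 'a \<Rightarrow> real" and B :: "'a set" +
  assumes lie: "lie_algebra br"
begin

abbreviation D :: "'a \<Rightarrow> 'a \<Rightarrow> 'a" where "D \<equiv> levi_civita br g"

abbreviation R :: "'a \<Rightarrow> 'a \<Rightarrow> 'a" where "R y \<equiv> \<lambda>x. D x y"

abbreviation J :: "'a \<Rightarrow> 'a \<Rightarrow> 'a" where "J y \<equiv> \<lambda>x. R y x - adj (R y) x"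

lemma bilinear_br: "bilinear br"
  using lie unfolding lie_algebra_def by blast

lemma br_anti: "br x y = - br y x"
proof -
  have alt: "br x x = 0" for x using lie unfolding lie_algebra_def by blast
  have "br (x + y) (x + y) = br x y + br y x"
    unfolding bilinear_ladd[OF bilinear_br] bilinear_radd[OF bilinear_br] by (simp add: alt)
  then show ?thesis by (simp add: alt eq_neg_iff_add_eq_0)
qed

lemma bilinear_D: "bilinear D"
  and torsion_free: "D x y - D y x = br x y"
  and D_skew: "g (D x y) z + g y (D x z) = 0"
  using is_levi_civita_levi_civita[OF basis lie metric] unfolding is_levi_civita_def by auto

lemma linear_br: "linear (br x)" and linear_D: "linear (D x)" and linear_R: "linear (R y)"
  using bilinear_br bilinear_D unfolding bilinear_def by auto

lemma linear_J: "linear (J y)"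
  by (simp add: linear_compose_sub linear_R linear_adj)

lemma br_eq: "br y x = D y x - R y x"
  by (simp add: torsion_free)

text \<open>\<open>R y\<close> is traceless because \<open>br y\<close> and the skew map
  \<open>D y\<close> are. Substituting torsion-freeness into the curvature leaves
  \<open>R (D y z)\<close>, the commutator of \<open>R z\<close> and \<open>D y\<close>, and minus
  \<open>R z\<close> after \<open>R y\<close>; only the last contributes to the trace.\<close>

lemma ricci_unimodular:
  assumes "unimodular br"
  shows "ricci_tensor br g y z = - lin_trace (\<lambda>x. R z (R y x))"
proof -
  have R0: "lin_trace (R y) = 0" for y
  proof -
    have "lin_trace (\<lambda>x. D y x - R y x) = 0"
      using assms unfolding unimodular_def br_eq[symmetric] by simp
    then show ?thesis
      by (simp add: trace_diff linear_D linear_R trace_skew[OF linear_D D_skew])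
  qed
  have "curvature br g x y z = R (D y z) x - D y (R z x) - (R z (R y x) - R z (D y x))" for x
    by (simp add: curvature_def Let_def torsion_free[symmetric, of x y]
        bilinear_lsub[OF bilinear_D])
  then show ?thesis
    by (simp add: ricci_tensor_def trace_diff linear_compose_sub linear_comp_apply[OF linear_D]
        linear_comp_apply[OF linear_R] linear_R linear_D R0 trace_commute[OF linear_D linear_R])
qed

text \<open>Skewness of \<open>D x\<close> and \<open>D z\<close> moves \<open>y\<close> out of both
  terms of \<open>J y\<close>, and torsion-freeness combines what remains. Thus \<open>J\<close>
  depends only on the bracket and \<open>g\<close>.\<close>

lemma g_J: "g (J y x) z = g (br z x) y"
  using D_skew[of x y z] D_skew[of z y x]
  by (simp add: g_simps g_adj[OF linear_R] torsion_free[symmetric, of z x] g_sym[of _ y] g_sym[of x])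

lemma br_plus_adj: "br y x + adj (br y) x = - (R y x + adj (R y) x)"
proof (rule g_eqI)
  fix z
  show "g (br y x + adj (br y) x) z = g (- (R y x + adj (R y) x)) z"
    using D_skew[of y x z]
    by (simp add: g_simps g_adj[OF linear_R] g_adj[OF linear_br] torsion_free[symmetric, of y])
qed

lemma ricci_killing_zero:
  assumes uni: "unimodular br" and kill: "\<forall>v w. killing_form br v w = 0"
  shows "- 4 * ricci_tensor br g y z
    = 2 * lin_trace (\<lambda>x. br z (adj (br y) x)) + lin_trace (\<lambda>x. J z (J y x))"
proof -
  have k: "lin_trace (\<lambda>x. br z (br y x)) = 0"
    using kill unfolding killing_form_def o_def by blast
  have neg: "R z (- u) + adj (R z) (- u) = - (R z u + adj (R z) u)" for u
    by (simp add: linear_neg[OF linear_R] linear_neg[OF linear_adj])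
  have "lin_trace (\<lambda>x. br z (br y x + adj (br y) x) + adj (br z) (br y x + adj (br y) x))
      = lin_trace (\<lambda>x. R z (R y x + adj (R y) x) + adj (R z) (R y x + adj (R y) x))"
    by (simp only: br_plus_adj neg minus_minus)
  then have "2 * lin_trace (\<lambda>x. br z (adj (br y) x))
      = 2 * lin_trace (\<lambda>x. R z (R y x)) + 2 * lin_trace (\<lambda>x. R z (adj (R y) x))"
    unfolding trace_self_adjoint_parts[OF linear_br linear_br]
      trace_self_adjoint_parts[OF linear_R linear_R] by (simp add: k)
  \<comment> \<open>Adding the identity for the skew parts cancels the mixed trace of
    \<open>R z\<close> and \<open>adj (R y)\<close>, leaving four times the trace of
    \<open>R z\<close> after \<open>R y\<close>.\<close>
  with trace_skew_parts[OF linear_R[of z] linear_R[of y]] ricci_unimodular[OF uni, of y z]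
  show ?thesis by linarith
qed

section \<open>Index form of the two terms and contraction with a derivation\<close>

lemma trace_br_adj: "lin_trace (\<lambda>x. br z (adj (br y) x)) = (\<Sum>b\<in>B. g (br z (dual b)) (br y b))"
proof -
  have "lin_trace (\<lambda>x. br z (adj (br y) x)) = lin_trace (\<lambda>x. adj (br z) (br y x))"
    by (rule trace_adj_left[OF linear_br linear_br, symmetric])
  also have "\<dots> = (\<Sum>b\<in>B. g (adj (br z) (br y b)) (dual b))"
    by (simp only: trace_eq[OF linear_comp_apply[OF linear_adj linear_br]] g_sym[of "dual _" "adj _ _"])
  finally show ?thesis
    unfolding g_adj[OF linear_br] g_sym[of "br y _" "br z _"] .
qed

text \<open>By \<open>g_J\<close> and antisymmetry of the bracket, \<open>J y\<close> is skew,
  whence the minus sign; \<open>parseval\<close> then separates the two factors so that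
  \<open>g_J\<close> applies to each.\<close>

lemma trace_J_J:
  "lin_trace (\<lambda>x. J z (J y x))
    = - (\<Sum>b\<in>B. \<Sum>c\<in>B. g (br (dual c) (dual b)) y * g (br c b) z)"
proof -
  have skew: "g u (J y v) = - g (J y u) v" for u v
    unfolding g_sym[of u] g_J by (subst br_anti) (simp add: g_simps)
  have "lin_trace (\<lambda>x. J z (J y x)) = lin_trace (\<lambda>x. J y (J z x))"
    by (rule trace_commute[OF linear_J linear_J])
  also have "\<dots> = - (\<Sum>b\<in>B. g (J y (dual b)) (J z b))"
    unfolding trace_eq[OF linear_comp_apply[OF linear_J linear_J]] skew by (simp add: sum_negf)
  also have "(\<Sum>b\<in>B. g (J y (dual b)) (J z b))
      = (\<Sum>b\<in>B. \<Sum>c\<in>B. g (J y (dual b)) (dual c) * g (J z b) c)"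
    by (subst parseval[symmetric]) (simp only: g_sym[of "dual _"] g_sym[of _ "J z _"])
  finally show ?thesis
    unfolding g_J .
qed

lemma ricci_derivation:
  assumes uni: "unimodular br" and kill: "\<forall>v w. killing_form br v w = 0" and X: "X \<in> lie_der br"
  shows "(\<Sum>b\<in>B. ricci_tensor br g (X b) (dual b)) = 0"
proof -
  have lX: "linear X" and der: "X (br v w) = br (X v) w + br v (X w)" for v w
    using X unfolding lie_der_def by auto
  \<comment> \<open>Both contracted terms are multiples of this sum: the \<open>J\<close> term gives
    minus twice \<open>P\<close>, the adjoint term \<open>P\<close> itself with weight 2.\<close>
  define P where "P = (\<Sum>b\<in>B. \<Sum>c\<in>B. g (br (dual b) (dual c)) (br (X b) c))"
  have contract: "(\<Sum>a\<in>B. g v (X a) * g u (dual a)) = g v (X u)" for u v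
  proof -
    have "g v (X u) = g v (X (\<Sum>a\<in>B. g (dual a) u *\<^sub>R a))" by (simp add: expansion)
    then show ?thesis
      by (simp add: linear_sum[OF lX] linear_sum[OF linear_g_right] linear_scale[OF lX] g_simps
          g_sym[of "dual _"] mult.commute)
  qed
  have "(\<Sum>a\<in>B. lin_trace (\<lambda>x. J (dual a) (J (X a) x)))
      = - (\<Sum>a\<in>B. \<Sum>b\<in>B. \<Sum>c\<in>B. g (br (dual c) (dual b)) (X a) * g (br c b) (dual a))"
    unfolding trace_J_J sum_negf ..
  also have "(\<Sum>a\<in>B. \<Sum>b\<in>B. \<Sum>c\<in>B. g (br (dual c) (dual b)) (X a) * g (br c b) (dual a))
      = (\<Sum>b\<in>B. \<Sum>c\<in>B. \<Sum>a\<in>B. g (br (dual c) (dual b)) (X a) * g (br c b) (dual a))"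
    by (subst sum.swap, rule sum.cong[OF refl], rule sum.swap)
  \<comment> \<open>The sum over \<open>a\<close> puts \<open>X\<close> on \<open>br c b\<close>,
    where the Leibniz rule splits it in two.\<close>
  also have "\<dots> = (\<Sum>b\<in>B. \<Sum>c\<in>B. g (br (dual c) (dual b)) (br (X c) b))
      + (\<Sum>b\<in>B. \<Sum>c\<in>B. g (br (dual c) (dual b)) (br c (X b)))"
    unfolding contract der g_simps sum.distrib ..
  also have "(\<Sum>b\<in>B. \<Sum>c\<in>B. g (br (dual c) (dual b)) (br (X c) b)) = P"
    unfolding P_def by (rule sum.swap)
  \<comment> \<open>Both brackets are reversed, so the signs cancel.\<close>
  also have "(\<Sum>b\<in>B. \<Sum>c\<in>B. g (br (dual c) (dual b)) (br c (X b))) = P"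
    unfolding P_def
  proof (intro sum.cong refl)
    fix b c
    show "g (br (dual c) (dual b)) (br c (X b)) = g (br (dual b) (dual c)) (br (X b) c)"
      unfolding br_anti[of "dual c" "dual b"] br_anti[of c "X b"] g_simps by simp
  qed
  finally have J_sum: "(\<Sum>a\<in>B. lin_trace (\<lambda>x. J (dual a) (J (X a) x))) = - (2 * P)"
    by simp
  have "(\<Sum>a\<in>B. lin_trace (\<lambda>x. br (dual a) (adj (br (X a)) x))) = P"
    unfolding trace_br_adj P_def ..
  with J_sum have "(\<Sum>a\<in>B. - 4 * ricci_tensor br g (X a) (dual a)) = 0"
    unfolding ricci_killing_zero[OF uni kill] sum.distrib sum_distrib_left[symmetric] by simp
  then show ?thesis
    unfolding sum_distrib_left[symmetric] by simp
qed

end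

theorem theorem4p1:
  fixes br :: "'a::real_vector \<Rightarrow> 'a \<Rightarrow> 'a"
  assumes findim: "\<exists>B :: 'a set. finite_dimensional_vector_space (*\<^sub>R) B"
    and lie: "lie_algebra br"
    and unimod: "unimodular br"
    and killing_zero: "\<forall>v w. killing_form br v w = 0"
    and einstein_metric: "\<exists>g. lie_metric g \<and> einstein br g \<and> scalar_curvature br g \<noteq> 0"
  shows "lie_der br \<subseteq> traceless"
proof
  fix X assume X: "X \<in> lie_der br"
  then have lX: "linear X" unfolding lie_der_def by blast
  obtain B :: "'a set" where B: "finite_dimensional_vector_space (*\<^sub>R) B"
    using findim by blast
  obtain g c where g: "lie_metric g" and ric: "\<And>v. ricci_operator br g v = c *\<^sub>R v"
    and scal: "scalar_curvature br g \<noteq> 0"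
    using einstein_metric unfolding einstein_def by blast
  interpret metric_lie_algebra br g B
    by (intro metric_lie_algebra.intro metric_with_basis.intro metric_lie_algebra_axioms.intro B g lie)
  have "scalar_curvature br g = c * lin_trace (\<lambda>x :: 'a. x)"
    unfolding scalar_curvature_def ric[abs_def] by (rule trace_scale[OF linear_ident])
  with scal have c: "c \<noteq> 0" by auto
  \<comment> \<open>Since \<open>c *\<^sub>R X b\<close> is the Ricci operator at
    \<open>X b\<close>, this is the contraction of \<open>ricci_derivation\<close>.\<close>
  have "c * lin_trace X = (\<Sum>b\<in>B. g (c *\<^sub>R X b) (dual b))"
    by (simp add: trace_eq lX sum_distrib_left g_simps g_sym[of "dual _"])
  also have "\<dots> = 0"
    using ricci_derivation[OF unimod killing_zero X]
    by (simp add: ricci_operator_tensor[OF B lie g, symmetric] ric)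
  finally show "X \<in> traceless"
    using c lX unfolding traceless_def by simp
qed

end
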